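(* Let $S$ be an $E$-solid locally inverse semigroup and $\rho$ an inverse semigroup congruence on $S$ such that each idempotent $\rho$-class (i.e. each class $e\rho$ with $e$ an idempotent of $S$), regarded as a subsemigroup of $S$, is a completely simple semigroup. Then there exist a completely simple semigroup $K$ and an action of the inverse semigroup $T=S/\rho$ on $K$ by endomorphisms on the left such that the extension $(S,\rho)$ can be embedded into the $\lambda$-semidirect product extension $(K\rtimes_\lambda T,\vartheta_2)$; that is, there is an injective homomorphism $\psi\colon S\to K\rtimes_\lambda T$ such that the congruence on $S$ induced by $\psi\vartheta_2^\natural$ (equivalently, by $\psi$ followed by the second projection onto $T$) is exactly $\rho$.
   Context: A semigroup is locally inverse if it is regular and every local submonoid $eSe$ ($e$ idempotent) is an inverse semigroup. A semigroup is $E$-solid if the subsemigroup generated by its idempotents is completely regular. A congruence $\rho$ on $S$ is an inverse semigroup congruence if $S/\rho$ is an inverse semigroup. An extension by an inverse semigroup is a pair $(S,\rho)$ with $\rho$ an inverse semigroup congruence on $S$. If $(S,\rho)$ and $(U,\sigma)$ are such extensions, an embedding of $(S,\rho)$ into $(U,\sigma)$ is an injective homomorphism $\psi\colon S\to U$ such that the kernel of $\psi\sigma^\natural$ equals $\rho$. Let $K$ be a semigroup and $T$ an inverse semigroup; $T$ acts on $K$ (by endomorphisms on the left) if an antihomomorphism $t\mapsto\varepsilon_t$ from $T$ to the endomorphism monoid of $K$ is given (so $\varepsilon_u\varepsilon_t=\varepsilon_{tu}$, maps written on the right); write ${}^t a$ for $a\varepsilon_t$. The $\lambda$-semidirect product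 $K\rtimes_\lambda T$ is the set $\{(a,t)\in K\times T: {}^{tt^{-1}}a=a\}$ with multiplication $(a,t)(b,u)=({}^{(tu)(tu)^{-1}}a\cdot {}^t b,\ tu)$. The $\lambda$-semidirect product extension of $K$ by $T$ is the pair $(K\rtimes_\lambda T,\vartheta_2)$ where $\vartheta_2$ is the congruence induced by the second projection $(a,t)\mapsto t$. *)

theory Defs
  imports Main
begin

definition semigroup :: "'a set \<Rightarrow> ('a \<Rightarrow> 'a \<Rightarrow> 'a) \<Rightarrow> bool" where
  "semigroup S m \<longleftrightarrow> (\<forall>x\<in>S. \<forall>y\<in>S. m x y \<in> S) \<and>
     (\<forall>x\<in>S. \<forall>y\<in>S. \<forall>z\<in>S. m (m x y) z = m x (m y z))"

definition idem :: "('a \<Rightarrow> 'a \<Rightarrow> 'a) \<Rightarrow> 'a \<Rightarrow> bool" where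
  "idem m e \<longleftrightarrow> m e e = e"

definition idempotents :: "'a set \<Rightarrow> ('a \<Rightarrow> 'a \<Rightarrow> 'a) \<Rightarrow> 'a set" where
  "idempotents S m = {e\<in>S. idem m e}"

definition is_inverse :: "'a set \<Rightarrow> ('a \<Rightarrow> 'a \<Rightarrow> 'a) \<Rightarrow> 'a \<Rightarrow> 'a \<Rightarrow> bool" where
  "is_inverse S m a b \<longleftrightarrow> b \<in> S \<and> m (m a b) a = a \<and> m (m b a) b = b"

definition regular :: "'a set \<Rightarrow> ('a \<Rightarrow> 'a \<Rightarrow> 'a) \<Rightarrow> bool" where
  "regular S m \<longleftrightarrow> semigroup S m \<and> (\<forall>a\<in>S. \<exists>x\<in>S. m (m a x) a = a)"

definition inverse_semigroup :: "'a set \<Rightarrow> ('a \<Rightarrow> 'a \<Rightarrow> 'a) \<Rightarrow> bool" where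
  "inverse_semigroup S m \<longleftrightarrow> semigroup S m \<and> (\<forall>a\<in>S. \<exists>!b. is_inverse S m a b)"

definition sinv :: "'a set \<Rightarrow> ('a \<Rightarrow> 'a \<Rightarrow> 'a) \<Rightarrow> 'a \<Rightarrow> 'a" where
  "sinv S m a = (THE b. is_inverse S m a b)"

definition local_submonoid :: "'a set \<Rightarrow> ('a \<Rightarrow> 'a \<Rightarrow> 'a) \<Rightarrow> 'a \<Rightarrow> 'a set" where
  "local_submonoid S m e = {m (m e s) e | s. s \<in> S}"

definition locally_inverse :: "'a set \<Rightarrow> ('a \<Rightarrow> 'a \<Rightarrow> 'a) \<Rightarrow> bool" where
  "locally_inverse S m \<longleftrightarrow> regular S m \<and>
     (\<forall>e\<in>idempotents S m. inverse_semigroup (local_submonoid S m e) m)"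

definition subsemigroup :: "'a set \<Rightarrow> 'a set \<Rightarrow> ('a \<Rightarrow> 'a \<Rightarrow> 'a) \<Rightarrow> bool" where
  "subsemigroup A S m \<longleftrightarrow> A \<subseteq> S \<and> (\<forall>x\<in>A. \<forall>y\<in>A. m x y \<in> A)"

definition generated :: "'a set \<Rightarrow> ('a \<Rightarrow> 'a \<Rightarrow> 'a) \<Rightarrow> 'a set \<Rightarrow> 'a set" where
  "generated S m X = \<Inter> {A. subsemigroup A S m \<and> X \<subseteq> A}"

definition subgroup_of :: "'a set \<Rightarrow> 'a set \<Rightarrow> ('a \<Rightarrow> 'a \<Rightarrow> 'a) \<Rightarrow> bool" where
  "subgroup_of G S m \<longleftrightarrow> subsemigroup G S m \<and>
     (\<exists>e\<in>G. (\<forall>g\<in>G. m e g = g \<and> m g e = g) \<and> (\<forall>g\<in>G. \<exists>h\<in>G. m g h = e \<and> m h g = e))"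

definition completely_regular :: "'a set \<Rightarrow> ('a \<Rightarrow> 'a \<Rightarrow> 'a) \<Rightarrow> bool" where
  "completely_regular S m \<longleftrightarrow> semigroup S m \<and> (\<forall>a\<in>S. \<exists>G. subgroup_of G S m \<and> a \<in> G)"

definition E_solid :: "'a set \<Rightarrow> ('a \<Rightarrow> 'a \<Rightarrow> 'a) \<Rightarrow> bool" where
  "E_solid S m \<longleftrightarrow> completely_regular (generated S m (idempotents S m)) m"

definition ideal :: "'a set \<Rightarrow> 'a set \<Rightarrow> ('a \<Rightarrow> 'a \<Rightarrow> 'a) \<Rightarrow> bool" where
  "ideal I S m \<longleftrightarrow> I \<subseteq> S \<and> I \<noteq> {} \<and> (\<forall>s\<in>S. \<forall>x\<in>I. m s x \<in> I \<and> m x s \<in> I)"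

definition simple :: "'a set \<Rightarrow> ('a \<Rightarrow> 'a \<Rightarrow> 'a) \<Rightarrow> bool" where
  "simple S m \<longleftrightarrow> semigroup S m \<and> (\<forall>I. ideal I S m \<longrightarrow> I = S)"

definition primitive_idempotent :: "'a set \<Rightarrow> ('a \<Rightarrow> 'a \<Rightarrow> 'a) \<Rightarrow> 'a \<Rightarrow> bool" where
  "primitive_idempotent S m e \<longleftrightarrow> e \<in> idempotents S m \<and>
     (\<forall>f\<in>idempotents S m. m e f = f \<and> m f e = f \<longrightarrow> f = e)"

definition completely_simple :: "'a set \<Rightarrow> ('a \<Rightarrow> 'a \<Rightarrow> 'a) \<Rightarrow> bool" where
  "completely_simple S m \<longleftrightarrow> simple S m \<and> (\<exists>e. primitive_idempotent S m e)"

definition congruence :: "'a set \<Rightarrow> ('a \<Rightarrow> 'a \<Rightarrow> 'a) \<Rightarrow> ('a \<times> 'a) set \<Rightarrow> bool" where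
  "congruence S m r \<longleftrightarrow> equiv S r \<and>
     (\<forall>a b c. (a, b) \<in> r \<longrightarrow> c \<in> S \<longrightarrow> (m c a, m c b) \<in> r \<and> (m a c, m b c) \<in> r)"

definition quot_mult :: "('a \<times> 'a) set \<Rightarrow> ('a \<Rightarrow> 'a \<Rightarrow> 'a) \<Rightarrow> 'a set \<Rightarrow> 'a set \<Rightarrow> 'a set" where
  "quot_mult r m X Y = r `` {m (SOME x. x \<in> X) (SOME y. y \<in> Y)}"

definition inverse_congruence :: "'a set \<Rightarrow> ('a \<Rightarrow> 'a \<Rightarrow> 'a) \<Rightarrow> ('a \<times> 'a) set \<Rightarrow> bool" where
  "inverse_congruence S m r \<longleftrightarrow> congruence S m r \<and> inverse_semigroup (S // r) (quot_mult r m)"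

text \<open>Left action of T on K by endomorphisms: t \<mapsto> eps t, with eps (t u) = eps t \<circ> eps u
  (i.e. the antihomomorphism into End(K) with maps written on the right).\<close>
definition endomorphism :: "'k set \<Rightarrow> ('k \<Rightarrow> 'k \<Rightarrow> 'k) \<Rightarrow> ('k \<Rightarrow> 'k) \<Rightarrow> bool" where
  "endomorphism K mK f \<longleftrightarrow> (\<forall>a\<in>K. f a \<in> K) \<and> (\<forall>a\<in>K. \<forall>b\<in>K. f (mK a b) = mK (f a) (f b))"

definition left_action ::
  "'t set \<Rightarrow> ('t \<Rightarrow> 't \<Rightarrow> 't) \<Rightarrow> 'k set \<Rightarrow> ('k \<Rightarrow> 'k \<Rightarrow> 'k) \<Rightarrow> ('t \<Rightarrow> 'k \<Rightarrow> 'k) \<Rightarrow> bool" where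
  "left_action T mT K mK eps \<longleftrightarrow>
     (\<forall>t\<in>T. endomorphism K mK (eps t)) \<and>
     (\<forall>t\<in>T. \<forall>u\<in>T. \<forall>a\<in>K. eps (mT t u) a = eps t (eps u a))"

definition lsd_carrier ::
  "'k set \<Rightarrow> 't set \<Rightarrow> ('t \<Rightarrow> 't \<Rightarrow> 't) \<Rightarrow> ('t \<Rightarrow> 'k \<Rightarrow> 'k) \<Rightarrow> ('k \<times> 't) set" where
  "lsd_carrier K T mT eps = {(a, t). a \<in> K \<and> t \<in> T \<and> eps (mT t (sinv T mT t)) a = a}"

definition lsd_mult ::
  "('k \<Rightarrow> 'k \<Rightarrow> 'k) \<Rightarrow> 't set \<Rightarrow> ('t \<Rightarrow> 't \<Rightarrow> 't) \<Rightarrow> ('t \<Rightarrow> 'k \<Rightarrow> 'k)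
     \<Rightarrow> 'k \<times> 't \<Rightarrow> 'k \<times> 't \<Rightarrow> 'k \<times> 't" where
  "lsd_mult mK T mT eps p q =
     (let a = fst p; t = snd p; b = fst q; u = snd q; tu = mT t u
      in (mK (eps (mT tu (sinv T mT tu)) a) (eps t b), tu))"

end

theory Submission
  imports Defs "HOL-Algebra.Group"
begin

text \<open>
  Let \<open>T = S / \<rho>\<close> and let \<open>\<pi>\<close> be the projection. Regard \<open>a \<in> S\<close> over \<open>t = \<pi> a\<close> as an arrow
  \<open>z \<rightarrow> z t\<close> for every \<open>z \<in> T\<close> with \<open>z t t\<inverse> = z\<close>; the connected components of this category are
  the \<open>\<R>\<close>-classes of \<open>T\<close>. It suffices to represent the arrows of the component of each idempotent
  \<open>e\<close> by elements of a completely simple semigroup \<open>L\<^sub>e\<close>: the product \<open>K\<close> of the \<open>L\<^bsub>x x\<inverse>\<^esub>\<close> over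
  \<open>x \<in> T\<close> is completely simple, \<open>T\<close> acts on it by \<open>({}\<^sup>t f) x = f (x t)\<close>, with a fixed idempotent as
  value where \<open>x \<rightarrow> x t\<close> is not an arrow, and \<open>a\<close> is sent to the family of its representatives.

  Let \<open>\<epsilon>\<close> be an idempotent over \<open>e\<close> and \<open>N\<close> the group \<open>\<epsilon> (e\<rho>) \<epsilon>\<close>. Fix \<open>r\<^sub>z \<in> \<epsilon> S\<close> over \<open>z\<close> and
  \<open>s\<^sub>z \<in> S \<epsilon>\<close> over \<open>z\<inverse>\<close>. An arrow \<open>a : z \<rightarrow> y\<close> closes a loop \<open>n = r\<^sub>z a s\<^sub>y \<in> N\<close>, and its
  representative is \<open>(a s\<^sub>y n\<inverse>, n, n\<inverse> r\<^sub>z a)\<close> in a Rees matrix semigroup over \<open>N\<close> whose sandwich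
  entries are products in \<open>S\<close>. The outer coordinates \<open>w\<close> and \<open>v\<close> satisfy \<open>r\<^sub>z w = \<epsilon> = v s\<^sub>y\<close>. In a
  locally inverse semigroup any two such \<open>v\<close> with \<open>v f = v\<close> for a common idempotent \<open>f\<close> coincide, and
  dually for \<open>w\<close>; hence \<open>w\<close> depends only on the first factor of a composite arrow and \<open>v\<close> on the last.
\<close>

unbundle no converse_syntax

section \<open>Completely simple semigroups\<close>

locale semigroup_on =
  fixes S :: "'a set" and m :: "'a \<Rightarrow> 'a \<Rightarrow> 'a" (infixl "\<cdot>" 70)
  assumes semigroup: "semigroup S (\<cdot>)"
begin

lemma closed [simp]: "x \<in> S \<Longrightarrow> y \<in> S \<Longrightarrow> x \<cdot> y \<in> S"
  and assoc [simp]: "x \<in> S \<Longrightarrow> y \<in> S \<Longrightarrow> z \<in> S \<Longrightarrow> x \<cdot> y \<cdot> z = x \<cdot> (y \<cdot> z)"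
  using semigroup by (auto simp: semigroup_def)

lemma left_absorb: "e \<in> S \<Longrightarrow> x \<in> S \<Longrightarrow> z \<in> S \<Longrightarrow> e \<cdot> x = x \<Longrightarrow> e \<cdot> (x \<cdot> z) = x \<cdot> z"
  and right_absorb: "x \<in> S \<Longrightarrow> e \<in> S \<Longrightarrow> z \<in> S \<Longrightarrow> x \<cdot> e = x \<Longrightarrow> x \<cdot> (e \<cdot> z) = x \<cdot> z"
  by (metis assoc)+

lemma simple_factor:
  assumes "simple S (\<cdot>)" "a \<in> S" "b \<in> S"
  obtains x y where "x \<in> S" "y \<in> S" "b = x \<cdot> (a \<cdot> y)"
proof -
  define J where "J = {x \<cdot> (a \<cdot> y) | x y. x \<in> S \<and> y \<in> S}"
  have "ideal J S (\<cdot>)"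
    unfolding ideal_def
  proof (intro conjI ballI)
    show "J \<subseteq> S" "J \<noteq> {}"
      using assms by (auto simp: J_def)
  next
    fix s z assume s: "s \<in> S" and "z \<in> J"
    then obtain x y where z: "z = x \<cdot> (a \<cdot> y)" "x \<in> S" "y \<in> S"
      by (auto simp: J_def)
    then have "s \<cdot> z = (s \<cdot> x) \<cdot> (a \<cdot> y)" "z \<cdot> s = x \<cdot> (a \<cdot> (y \<cdot> s))"
      using s assms by simp_all
    then show "s \<cdot> z \<in> J" "z \<cdot> s \<in> J"
      using s z(2,3) unfolding J_def by (blast intro: closed)+
  qed
  then have "b \<in> J"
    using assms unfolding simple_def by metis
  then show thesis
    using that by (auto simp: J_def)
qed

lemma primitive_idempotentD:
  assumes "primitive_idempotent S (\<cdot>) e"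
  shows "e \<in> S" "e \<cdot> e = e"
    and "f \<in> S \<Longrightarrow> f \<cdot> f = f \<Longrightarrow> e \<cdot> f = f \<Longrightarrow> f \<cdot> e = f \<Longrightarrow> f = e"
  using assms by (auto simp: primitive_idempotent_def idempotents_def idem_def)

lemma primitive_idempotent_inverse:
  assumes e: "primitive_idempotent S (\<cdot>) e"
    and d: "d \<in> S" "e \<cdot> d = d" "d \<cdot> e = d" and c: "c \<in> S" "e \<cdot> c = c" "c \<cdot> e = c"
    and cdc: "c \<cdot> (d \<cdot> c) = c"
  shows "d \<cdot> c = e" "c \<cdot> d = e"
proof -
  note eS = primitive_idempotentD(1)[OF e]
  show "d \<cdot> c = e"
  proof (rule primitive_idempotentD(3)[OF e])
    show "d \<cdot> c \<cdot> (d \<cdot> c) = d \<cdot> c"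
      using c d cdc by simp
  qed (use c d eS in \<open>simp_all add: left_absorb\<close>)
  show "c \<cdot> d = e"
  proof (rule primitive_idempotentD(3)[OF e])
    show "c \<cdot> d \<cdot> (c \<cdot> d) = c \<cdot> d"
      using c d cdc by (metis assoc closed)
  qed (use c d eS in \<open>simp_all add: left_absorb\<close>)
qed

lemma primitive_idempotent_local_inverse:
  assumes simple: "simple S (\<cdot>)" and e: "primitive_idempotent S (\<cdot>) e" and b: "b \<in> S"
  obtains c where "c \<in> S" "e \<cdot> (b \<cdot> (e \<cdot> c)) = e" "c \<cdot> (e \<cdot> (b \<cdot> e)) = e"
proof -
  note eS = primitive_idempotentD(1)[OF e] and ee = primitive_idempotentD(2)[OF e]
  define d where "d = e \<cdot> (b \<cdot> e)"
  have d: "d \<in> S" "e \<cdot> d = d" "d \<cdot> e = d"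
    using b eS ee by (simp_all add: d_def left_absorb)
  obtain x y where xy: "x \<in> S" "y \<in> S" "e = x \<cdot> (d \<cdot> y)"
    using simple_factor[OF simple d(1) eS] .
  define u v where "u = e \<cdot> (x \<cdot> e)" and "v = e \<cdot> (y \<cdot> e)"
  have u: "u \<in> S" "e \<cdot> u = u" "u \<cdot> e = u" and v: "v \<in> S" "e \<cdot> v = v" "v \<cdot> e = v"
    using xy(1,2) eS ee by (simp_all add: u_def v_def left_absorb)
  have "u \<cdot> (d \<cdot> v) = e \<cdot> (x \<cdot> (d \<cdot> y)) \<cdot> e"
    using xy(1,2) eS d(1) by (simp add: u_def v_def d left_absorb right_absorb)
  then have udv: "u \<cdot> (d \<cdot> v) = e"
    using xy(3) ee by simp
  define c where "c = v \<cdot> u"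
  have c: "c \<in> S" "e \<cdot> c = c" "c \<cdot> e = c"
    using u v eS by (simp_all add: c_def left_absorb)
  have "c \<cdot> (d \<cdot> c) = v \<cdot> (u \<cdot> (d \<cdot> v)) \<cdot> u"
    using u v d by (simp add: c_def)
  then have "c \<cdot> (d \<cdot> c) = c"
    using udv v by (simp add: c_def)
  from primitive_idempotent_inverse[OF e d c this] show thesis
    using that[of c] c b eS by (simp add: d_def)
qed

lemma completely_simple_divides:
  assumes cs: "completely_simple S (\<cdot>)" and ab: "a \<in> S" "b \<in> S"
  shows "\<exists>x\<in>S. a \<cdot> (b \<cdot> x) = a" "\<exists>x\<in>S. x \<cdot> (b \<cdot> a) = a"
proof -
  have simple: "simple S (\<cdot>)"
    using cs by (simp add: completely_simple_def)
  obtain e where e: "primitive_idempotent S (\<cdot>) e" and eS: "e \<in> S"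
    using cs by (auto simp: completely_simple_def primitive_idempotent_def idempotents_def)
  obtain x y where xy: "x \<in> S" "y \<in> S" "a = x \<cdot> (e \<cdot> y)"
    using simple_factor[OF simple eS ab(1)] .
  obtain c where c: "c \<in> S" "e \<cdot> ((y \<cdot> (b \<cdot> x)) \<cdot> (e \<cdot> c)) = e" "c \<cdot> (e \<cdot> ((y \<cdot> (b \<cdot> x)) \<cdot> e)) = e"
    using primitive_idempotent_local_inverse[OF simple e, of "y \<cdot> (b \<cdot> x)"] xy(1,2) ab(2) by auto
  have "a \<cdot> (b \<cdot> (x \<cdot> (e \<cdot> (c \<cdot> y)))) = x \<cdot> ((e \<cdot> ((y \<cdot> (b \<cdot> x)) \<cdot> (e \<cdot> c))) \<cdot> y)"
    using xy c(1) eS ab(2) by simp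
  then have "a \<cdot> (b \<cdot> (x \<cdot> (e \<cdot> (c \<cdot> y)))) = a"
    using c(2) xy(3) by simp
  then show "\<exists>x\<in>S. a \<cdot> (b \<cdot> x) = a"
    using xy(1,2) c(1) eS by (intro bexI[of _ "x \<cdot> (e \<cdot> (c \<cdot> y))"]) simp_all
  have "(x \<cdot> (c \<cdot> (e \<cdot> y))) \<cdot> (b \<cdot> a) = x \<cdot> ((c \<cdot> (e \<cdot> ((y \<cdot> (b \<cdot> x)) \<cdot> e))) \<cdot> y)"
    using xy c(1) eS ab(2) by simp
  then have "(x \<cdot> (c \<cdot> (e \<cdot> y))) \<cdot> (b \<cdot> a) = a"
    using c(3) xy(3) by simp
  then show "\<exists>x\<in>S. x \<cdot> (b \<cdot> a) = a"
    using xy(1,2) c(1) eS by (intro bexI[of _ "x \<cdot> (c \<cdot> (e \<cdot> y))"]) simp_all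
qed

lemma simple_if_divides:
  assumes divides: "\<And>a b. a \<in> S \<Longrightarrow> b \<in> S \<Longrightarrow> \<exists>x\<in>S. a \<cdot> (b \<cdot> x) = a"
  shows "simple S (\<cdot>)"
  unfolding simple_def
proof (intro conjI allI impI)
  fix I assume I: "ideal I S (\<cdot>)"
  then obtain b where b: "b \<in> I" "b \<in> S"
    by (auto simp: ideal_def)
  have "a \<in> I" if a: "a \<in> S" for a
  proof -
    obtain x where "x \<in> S" "a \<cdot> (b \<cdot> x) = a"
      using divides[OF a b(2)] by blast
    then show ?thesis
      using I a b unfolding ideal_def by metis
  qed
  then show "I = S"
    using I by (auto simp: ideal_def)
qed (rule semigroup)

lemma primitive_idempotent_if_divides:
  assumes divides: "\<And>a b. a \<in> S \<Longrightarrow> b \<in> S \<Longrightarrow> \<exists>x\<in>S. a \<cdot> (b \<cdot> x) = a"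
    and a: "a \<in> S" and x: "x \<in> S" "a \<cdot> (a \<cdot> x) = a" and y: "y \<in> S" "y \<cdot> (a \<cdot> a) = a"
  shows "primitive_idempotent S (\<cdot>) (a \<cdot> x)"
proof -
  define e where "e = a \<cdot> x"
  have e: "e \<in> S"
    using a x by (simp add: e_def)
  have "e = y \<cdot> (a \<cdot> (a \<cdot> x))"
    using a x(1) y by (metis e_def assoc closed)
  then have "e = y \<cdot> a"
    using x(2) by simp
  then have "e \<cdot> e = y \<cdot> (a \<cdot> (a \<cdot> x))"
    using a x(1) y(1) by (metis e_def assoc closed)
  then have ee: "e \<cdot> e = e"
    using x(2) \<open>e = y \<cdot> a\<close> by simp
  have "f = e" if f: "f \<in> S" "f \<cdot> f = f" "e \<cdot> f = f" "f \<cdot> e = f" for f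
  proof -
    obtain z where z: "z \<in> S" "e \<cdot> (f \<cdot> z) = e"
      using divides[OF e f(1)] by blast
    then have "f \<cdot> z = e"
      using e f by (simp add: left_absorb)
    then show ?thesis
      using z(1) f by (metis assoc)
  qed
  with e ee show ?thesis
    by (auto simp: primitive_idempotent_def idempotents_def idem_def e_def)
qed

end

lemma completely_simple_iff:
  "completely_simple S m \<longleftrightarrow> semigroup S m \<and> S \<noteq> {} \<and>
     (\<forall>a\<in>S. \<forall>b\<in>S. (\<exists>x\<in>S. m a (m b x) = a) \<and> (\<exists>x\<in>S. m x (m b a) = a))"
  (is "_ \<longleftrightarrow> ?divides")
proof
  assume cs: "completely_simple S m"
  then interpret semigroup_on S m
    by unfold_locales (simp add: completely_simple_def simple_def)
  show ?divides
    using cs semigroup completely_simple_divides[OF cs]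
    by (auto simp: completely_simple_def primitive_idempotent_def idempotents_def)
next
  assume divides: ?divides
  then interpret semigroup_on S m
    by unfold_locales simp
  obtain a where "a \<in> S"
    using divides by blast
  then have "\<exists>e. primitive_idempotent S m e"
    using divides primitive_idempotent_if_divides by metis
  then show "completely_simple S m"
    using divides simple_if_divides by (simp add: completely_simple_def)
qed

lemma PiE_choice:
  assumes "\<And>i. i \<in> I \<Longrightarrow> \<exists>x\<in>A i. P i x"
  obtains h where "h \<in> PiE I A" "\<forall>i\<in>I. P i (h i)"
proof -
  have "\<forall>i\<in>I. \<exists>x. x \<in> A i \<and> P i x"
    using assms by blast
  from bchoice[OF this] obtain h where "\<forall>i\<in>I. h i \<in> A i \<and> P i (h i)" ..
  then show thesis
    by (intro that[of "restrict h I"]) simp_all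
qed

definition pointwise :: "'i set \<Rightarrow> ('i \<Rightarrow> 'b \<Rightarrow> 'b \<Rightarrow> 'b) \<Rightarrow> ('i \<Rightarrow> 'b) \<Rightarrow> ('i \<Rightarrow> 'b) \<Rightarrow> 'i \<Rightarrow> 'b" where
  "pointwise I mul f g = (\<lambda>i\<in>I. mul i (f i) (g i))"

lemma completely_simple_PiE:
  assumes cs: "\<And>i. i \<in> I \<Longrightarrow> completely_simple (A i) (mul i)"
  shows "completely_simple (PiE I A) (pointwise I mul)"
  unfolding completely_simple_iff
proof (intro conjI ballI)
  have factor: "semigroup (A i) (mul i)" "A i \<noteq> {}"
    "x \<in> A i \<Longrightarrow> y \<in> A i \<Longrightarrow> \<exists>z\<in>A i. mul i x (mul i y z) = x"
    "x \<in> A i \<Longrightarrow> y \<in> A i \<Longrightarrow> \<exists>z\<in>A i. mul i z (mul i y x) = x" if "i \<in> I" for i x y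
    using cs[OF that] unfolding completely_simple_iff by blast+
  show "semigroup (PiE I A) (pointwise I mul)"
    using factor(1) by (auto simp: semigroup_def pointwise_def PiE_mem intro!: restrict_ext)
  show "PiE I A \<noteq> {}"
    using factor(2) by (simp add: PiE_eq_empty_iff)
  fix f g assume f: "f \<in> PiE I A" and g: "g \<in> PiE I A"
  obtain h where h: "h \<in> PiE I A" "\<forall>i\<in>I. mul i (f i) (mul i (g i) (h i)) = f i"
    using factor(3)[OF _ PiE_mem[OF f] PiE_mem[OF g]] by (rule PiE_choice)
  have "pointwise I mul f (pointwise I mul g h) = f"
    using h(2) by (intro ext) (simp add: pointwise_def PiE_arb[OF f])
  then show "\<exists>h\<in>PiE I A. pointwise I mul f (pointwise I mul g h) = f"
    using h(1) ..
  obtain h where h: "h \<in> PiE I A" "\<forall>i\<in>I. mul i (h i) (mul i (g i) (f i)) = f i"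
    using factor(4)[OF _ PiE_mem[OF f] PiE_mem[OF g]] by (rule PiE_choice)
  have "pointwise I mul h (pointwise I mul g f) = f"
    using h(2) by (intro ext) (simp add: pointwise_def PiE_arb[OF f])
  then show "\<exists>h\<in>PiE I A. pointwise I mul h (pointwise I mul g f) = f"
    using h(1) ..
qed

definition rees_mult ::
  "('g, 'm) monoid_scheme \<Rightarrow> ('b \<Rightarrow> 'a \<Rightarrow> 'g) \<Rightarrow> 'a \<times> 'g \<times> 'b \<Rightarrow> 'a \<times> 'g \<times> 'b \<Rightarrow> 'a \<times> 'g \<times> 'b" where
  "rees_mult G p = (\<lambda>(a, g, b) (a', g', b'). (a, g \<otimes>\<^bsub>G\<^esub> p b a' \<otimes>\<^bsub>G\<^esub> g', b'))"

lemma (in group) completely_simple_rees: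
  assumes ne: "A \<noteq> {}" "B \<noteq> {}" and p: "\<And>b a. b \<in> B \<Longrightarrow> a \<in> A \<Longrightarrow> p b a \<in> carrier G"
  shows "completely_simple (A \<times> carrier G \<times> B) (rees_mult G p)"
  unfolding completely_simple_iff
proof (intro conjI ballI)
  show "semigroup (A \<times> carrier G \<times> B) (rees_mult G p)"
    using p by (auto simp: semigroup_def rees_mult_def m_assoc)
  show "A \<times> carrier G \<times> B \<noteq> {}"
    using ne by auto
  fix s t assume "s \<in> A \<times> carrier G \<times> B" "t \<in> A \<times> carrier G \<times> B"
  then obtain a g b a' g' b' where st: "s = (a, g, b)" "t = (a', g', b')"
    and mem: "a \<in> A" "g \<in> carrier G" "b \<in> B" "a' \<in> A" "g' \<in> carrier G" "b' \<in> B"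
    by auto
  let ?r = "p b a' \<otimes> g' \<otimes> p b' a'" and ?l = "p b' a' \<otimes> g' \<otimes> p b' a"
  define r l where "r = inv ?r" and "l = inv ?l"
  have r: "r \<in> carrier G" "?r \<otimes> r = \<one>" and l: "l \<in> carrier G" "l \<otimes> ?l = \<one>"
    using mem p unfolding r_def l_def by simp_all
  have "g \<otimes> p b a' \<otimes> (g' \<otimes> p b' a' \<otimes> r) = g \<otimes> (?r \<otimes> r)"
    using mem p r(1) by (simp add: m_assoc del: l_cancel_one)
  then have "rees_mult G p s (rees_mult G p t (a', r, b)) = s"
    using mem r by (simp add: st rees_mult_def)
  then show "\<exists>x\<in>A \<times> carrier G \<times> B. rees_mult G p s (rees_mult G p t x) = s"
    using mem r by blast
  have "l \<otimes> p b' a' \<otimes> (g' \<otimes> p b' a \<otimes> g) = l \<otimes> ?l \<otimes> g"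
    using mem p l(1) by (simp add: m_assoc)
  then have "rees_mult G p (a, l, b') (rees_mult G p t s) = s"
    using mem l by (simp add: st rees_mult_def)
  then show "\<exists>x\<in>A \<times> carrier G \<times> B. rees_mult G p x (rees_mult G p t s) = s"
    using mem l by blast
qed

definition transport_mult :: "('k \<Rightarrow> 'l) \<Rightarrow> 'k set \<Rightarrow> ('k \<Rightarrow> 'k \<Rightarrow> 'k) \<Rightarrow> 'l \<Rightarrow> 'l \<Rightarrow> 'l" where
  "transport_mult f K mK p q = f (mK (inv_into K f p) (inv_into K f q))"

lemma completely_simple_transport:
  assumes cs: "completely_simple K mK" and inj: "inj_on f K"
  shows "completely_simple (f ` K) (transport_mult f K mK)"
  unfolding completely_simple_iff
proof (intro conjI ballI)
  interpret semigroup_on K mK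
    using cs by unfold_locales (simp add: completely_simple_iff)
  have transport: "transport_mult f K mK (f x) (f y) = f (mK x y)" if "x \<in> K" "y \<in> K" for x y
    using inj that by (simp add: transport_mult_def)
  show "semigroup (f ` K) (transport_mult f K mK)"
    by (auto simp: semigroup_def transport)
  show "f ` K \<noteq> {}"
    using cs by (simp add: completely_simple_iff)
  fix p q assume "p \<in> f ` K" "q \<in> f ` K"
  then obtain x y where xy: "x \<in> K" "p = f x" "y \<in> K" "q = f y"
    by blast
  have "\<exists>z\<in>K. mK x (mK y z) = x" "\<exists>z\<in>K. mK z (mK y x) = x"
    using cs xy(1,3) unfolding completely_simple_iff by blast+
  then have "\<exists>z\<in>K. f (mK x (mK y z)) = f x" "\<exists>z\<in>K. f (mK z (mK y x)) = f x"
    by metis+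
  then show "\<exists>r\<in>f ` K. transport_mult f K mK p (transport_mult f K mK q r) = p"
    "\<exists>r\<in>f ` K. transport_mult f K mK r (transport_mult f K mK q p) = p"
    by (simp_all add: xy transport)
qed

definition local_group :: "'a set \<Rightarrow> ('a \<Rightarrow> 'a \<Rightarrow> 'a) \<Rightarrow> 'a \<Rightarrow> 'a monoid" where
  "local_group P m k = \<lparr>carrier = {x \<in> P. m k x = x \<and> m x k = x}, mult = m, one = k\<rparr>"

lemma group_local_group:
  assumes cs: "completely_simple P m" and k: "k \<in> idempotents P m"
  shows "group (local_group P m k)"
proof -
  interpret semigroup_on P m
    using cs by unfold_locales (simp add: completely_simple_iff)
  have kP: "k \<in> P" and kk: "m k k = k"
    using k by (auto simp: idempotents_def idem_def)
  show ?thesis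
  proof (rule groupI)
    fix x y assume "x \<in> carrier (local_group P m k)" "y \<in> carrier (local_group P m k)"
    then show "x \<otimes>\<^bsub>local_group P m k\<^esub> y \<in> carrier (local_group P m k)"
      using kP by (simp add: local_group_def) (metis assoc)
  next
    fix x assume "x \<in> carrier (local_group P m k)"
    then have x: "x \<in> P" "m k x = x" "m x k = x"
      by (simp_all add: local_group_def)
    obtain y where y: "y \<in> P" "m y (m x k) = k"
      using cs kP x(1) unfolding completely_simple_iff by blast
    then have "m (m k (m y k)) x = k"
      using x kP kk by simp
    then show "\<exists>y\<in>carrier (local_group P m k). y \<otimes>\<^bsub>local_group P m k\<^esub> x = \<one>\<^bsub>local_group P m k\<^esub>"
      using y(1) kP kk
      by (intro bexI[of _ "m k (m y k)"]) (simp_all add: local_group_def left_absorb)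
  qed (use kP kk in \<open>simp_all add: local_group_def\<close>)
qed

section \<open>Inverse semigroups\<close>

locale inverse_semigroup_on =
  fixes T :: "'t set" and m :: "'t \<Rightarrow> 't \<Rightarrow> 't" (infixl "\<odot>" 70)
  assumes inverse_semigroup: "inverse_semigroup T (\<odot>)"
begin

sublocale semigroup_on T "(\<odot>)"
  using inverse_semigroup by unfold_locales (simp add: inverse_semigroup_def)

abbreviation inverse :: "'t \<Rightarrow> 't" ("_\<inverse>" [1000] 999) where
  "x\<inverse> \<equiv> sinv T (\<odot>) x"

lemma is_inverse_inverse: "x \<in> T \<Longrightarrow> is_inverse T (\<odot>) x (x\<inverse>)"
  using inverse_semigroup unfolding inverse_semigroup_def sinv_def by (metis theI')

lemma inverse_closed [simp]: "x \<in> T \<Longrightarrow> x\<inverse> \<in> T"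
  using is_inverse_inverse by (simp add: is_inverse_def)

lemma mult_inverse_mult [simp]: "x \<in> T \<Longrightarrow> x \<odot> (x\<inverse> \<odot> x) = x"
  and inverse_mult_inverse [simp]: "x \<in> T \<Longrightarrow> x\<inverse> \<odot> (x \<odot> x\<inverse>) = x\<inverse>"
  using is_inverse_inverse[of x] by (simp_all add: is_inverse_def)

lemma inverse_eqI:
  assumes "x \<in> T" "y \<in> T" "x \<odot> (y \<odot> x) = x" "y \<odot> (x \<odot> y) = y"
  shows "x\<inverse> = y"
proof -
  have "is_inverse T (\<odot>) x y"
    using assms by (simp add: is_inverse_def)
  then show ?thesis
    using assms(1) is_inverse_inverse inverse_semigroup unfolding inverse_semigroup_def by blast
qed

lemma inverse_inverse [simp]: "x \<in> T \<Longrightarrow> (x\<inverse>)\<inverse> = x"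
  by (rule inverse_eqI) simp_all

lemma inverse_idempotent: "e \<in> T \<Longrightarrow> e \<odot> e = e \<Longrightarrow> e\<inverse> = e"
  by (rule inverse_eqI) simp_all

lemma idempotent_mult:
  assumes e: "e \<in> T" "e \<odot> e = e" and f: "f \<in> T" "f \<odot> f = f"
  shows "e \<odot> f \<odot> (e \<odot> f) = e \<odot> f"
proof -
  define x where "x = (e \<odot> f)\<inverse>"
  have x: "x \<in> T"
    using e f by (simp add: x_def)
  have "e \<odot> f \<odot> (x \<odot> (e \<odot> f)) = e \<odot> f" "x \<odot> (e \<odot> f \<odot> x) = x"
    unfolding x_def using e(1) f(1) closed mult_inverse_mult inverse_mult_inverse by blast+
  then have efxef: "e \<odot> (f \<odot> (x \<odot> (e \<odot> f))) = e \<odot> f" and xefx: "x \<odot> (e \<odot> (f \<odot> x)) = x"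
    using e f x by simp_all
  have fxe: "f \<odot> x \<odot> e \<odot> (f \<odot> x \<odot> e) = f \<odot> x \<odot> e"
    using xefx e f x by (metis assoc closed)
  have "x = f \<odot> x \<odot> e"
    unfolding x_def
  proof (rule inverse_eqI, fold x_def)
    show "e \<odot> f \<odot> (f \<odot> x \<odot> e \<odot> (e \<odot> f)) = e \<odot> f"
      using efxef e f x by (simp add: left_absorb)
    show "f \<odot> x \<odot> e \<odot> (e \<odot> f \<odot> (f \<odot> x \<odot> e)) = f \<odot> x \<odot> e"
      using fxe e f x by (simp add: left_absorb)
  qed (use e f x in simp_all)
  then have xx: "x \<odot> x = x"
    using fxe by simp
  then have "e \<odot> f = x"
    using inverse_idempotent[of x] x e(1) f(1) inverse_inverse[of "e \<odot> f"] by (simp add: x_def)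
  with xx show ?thesis
    by simp
qed

lemma idempotent_commute:
  assumes e: "e \<in> T" "e \<odot> e = e" and f: "f \<in> T" "f \<odot> f = f"
  shows "e \<odot> f = f \<odot> e"
proof -
  have "e \<odot> (f \<odot> (e \<odot> f)) = e \<odot> f" "f \<odot> (e \<odot> (f \<odot> e)) = f \<odot> e"
    using idempotent_mult[OF e f] idempotent_mult[OF f e] e f by simp_all
  then have "(e \<odot> f)\<inverse> = f \<odot> e"
    using e f by (intro inverse_eqI) (simp_all add: left_absorb)
  moreover have "(e \<odot> f)\<inverse> = e \<odot> f"
    using e f idempotent_mult[OF e f] by (intro inverse_idempotent) simp_all
  ultimately show ?thesis
    by simp
qed

definition left_unit :: "'t \<Rightarrow> 't" where "left_unit x = x \<odot> x\<inverse>"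

lemma left_unit_closed [simp]: "x \<in> T \<Longrightarrow> left_unit x \<in> T"
  and left_unit_idem [simp]: "x \<in> T \<Longrightarrow> left_unit x \<odot> left_unit x = left_unit x"
  and left_unit_mult [simp]: "x \<in> T \<Longrightarrow> left_unit x \<odot> x = x"
  and inverse_mult_left_unit [simp]: "x \<in> T \<Longrightarrow> x\<inverse> \<odot> left_unit x = x\<inverse>"
  by (simp_all add: left_unit_def)

lemma left_unit_idempotents [simp]: "x \<in> T \<Longrightarrow> left_unit x \<in> idempotents T (\<odot>)"
  by (simp add: idempotents_def idem_def)

lemma left_unit_left_unit [simp]: "x \<in> T \<Longrightarrow> left_unit (left_unit x) = left_unit x"
  by (simp add: left_unit_def[of "left_unit x"] inverse_idempotent)

lemma inverse_mult_left_unit_commute: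
  "t \<in> T \<Longrightarrow> u \<in> T \<Longrightarrow> t\<inverse> \<odot> t \<odot> left_unit u = left_unit u \<odot> (t\<inverse> \<odot> t)"
  by (rule idempotent_commute) simp_all

lemma inverse_mult:
  assumes "x \<in> T" "y \<in> T"
  shows "(x \<odot> y)\<inverse> = y\<inverse> \<odot> x\<inverse>"
proof -
  have cancel: "x \<odot> y \<odot> (y\<inverse> \<odot> x\<inverse> \<odot> (x \<odot> y)) = x \<odot> y" if T: "x \<in> T" "y \<in> T" for x y
  proof -
    have commute: "y \<odot> y\<inverse> \<odot> (x\<inverse> \<odot> x) = x\<inverse> \<odot> x \<odot> (y \<odot> y\<inverse>)"
      using inverse_mult_left_unit_commute[OF T] by (simp add: left_unit_def)
    have "x \<odot> y \<odot> (y\<inverse> \<odot> x\<inverse> \<odot> (x \<odot> y)) = x \<odot> (y \<odot> y\<inverse> \<odot> (x\<inverse> \<odot> x)) \<odot> y"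
      using T by simp
    also have "\<dots> = x \<odot> (x\<inverse> \<odot> x) \<odot> (y \<odot> (y\<inverse> \<odot> y))"
      unfolding commute using T by (simp del: mult_inverse_mult)
    finally show ?thesis
      using T by (simp del: assoc)
  qed
  show ?thesis
    using assms cancel[of x y] cancel[of "y\<inverse>" "x\<inverse>"] by (intro inverse_eqI) simp_all
qed

lemma left_unit_product: "t \<in> T \<Longrightarrow> u \<in> T \<Longrightarrow> left_unit (t \<odot> u) = t \<odot> (left_unit u \<odot> t\<inverse>)"
  by (simp add: left_unit_def inverse_mult)

definition arrow :: "'t \<Rightarrow> 't \<Rightarrow> bool" where
  "arrow z t \<longleftrightarrow> z \<in> T \<and> t \<in> T \<and> z \<odot> left_unit t = z"

lemma arrow_left_unit_source: "t \<in> T \<Longrightarrow> arrow (left_unit t) t"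
  by (simp add: arrow_def)

lemma arrow_left_unit_iff: "t \<in> T \<Longrightarrow> arrow z (left_unit t) \<longleftrightarrow> arrow z t"
  by (simp add: arrow_def)

lemma left_unit_target:
  assumes "arrow z t"
  shows "left_unit (z \<odot> t) = left_unit z"
proof -
  have T: "z \<in> T" "t \<in> T" and z: "z \<odot> left_unit t = z"
    using assms by (simp_all add: arrow_def)
  have "left_unit (z \<odot> t) = z \<odot> left_unit t \<odot> z\<inverse>"
    using T by (simp add: left_unit_product)
  also have "\<dots> = left_unit z"
    by (simp only: z left_unit_def[of z])
  finally show ?thesis .
qed

lemma mult_inverse_target:
  assumes "arrow z t"
  shows "t \<odot> (z \<odot> t)\<inverse> = z\<inverse>"
proof -
  have T: "z \<in> T" "t \<in> T" and z: "z \<odot> left_unit t = z"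
    using assms by (simp_all add: arrow_def)
  have "t \<odot> (z \<odot> t)\<inverse> = (z \<odot> left_unit t)\<inverse>"
    using T by (simp add: left_unit_def inverse_mult)
  then show ?thesis
    by (simp only: z)
qed

lemma arrow_mult_iff:
  assumes T: "z \<in> T" "t \<in> T" "u \<in> T"
  shows "arrow z (t \<odot> u) \<longleftrightarrow> arrow z t \<and> arrow (z \<odot> t) u"
proof
  assume "arrow z (t \<odot> u)"
  then have z: "z \<odot> (t \<odot> (left_unit u \<odot> t\<inverse>)) = z"
    using T by (simp add: arrow_def left_unit_product)
  have "z \<odot> left_unit t = z \<odot> (t \<odot> (left_unit u \<odot> t\<inverse>)) \<odot> left_unit t"
    by (simp only: z)
  also have "\<dots> = z \<odot> (t \<odot> (left_unit u \<odot> t\<inverse>))"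
    using T by simp
  also note z
  finally have "arrow z t"
    using T by (simp add: arrow_def)
  have "z \<odot> t = z \<odot> (t \<odot> (left_unit u \<odot> t\<inverse>)) \<odot> t"
    by (simp only: z)
  also have "\<dots> = z \<odot> (t \<odot> (t\<inverse> \<odot> t) \<odot> left_unit u)"
    using T by (simp add: inverse_mult_left_unit_commute[symmetric] del: mult_inverse_mult)
  also have "\<dots> = z \<odot> t \<odot> left_unit u"
    using T by simp
  finally have "arrow (z \<odot> t) u"
    using T by (simp add: arrow_def)
  with \<open>arrow z t\<close> show "arrow z t \<and> arrow (z \<odot> t) u" ..
next
  assume arrows: "arrow z t \<and> arrow (z \<odot> t) u"
  have "z \<odot> left_unit (t \<odot> u) = z \<odot> t \<odot> left_unit u \<odot> t\<inverse>"
    using T by (simp add: left_unit_product)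
  also have "\<dots> = z \<odot> left_unit t"
    using arrows T by (simp add: arrow_def[of "z \<odot> t"] left_unit_def[of t])
  finally show "arrow z (t \<odot> u)"
    using arrows T by (simp add: arrow_def)
qed

end

section \<open>Embeddings into \<open>\<lambda>\<close>-semidirect products\<close>

definition lsd_embedding ::
  "'a set \<Rightarrow> ('a \<Rightarrow> 'a \<Rightarrow> 'a) \<Rightarrow> ('a \<Rightarrow> 't) \<Rightarrow> 't set \<Rightarrow> ('t \<Rightarrow> 't \<Rightarrow> 't) \<Rightarrow>
     'k set \<Rightarrow> ('k \<Rightarrow> 'k \<Rightarrow> 'k) \<Rightarrow> ('t \<Rightarrow> 'k \<Rightarrow> 'k) \<Rightarrow> ('a \<Rightarrow> 'k \<times> 't) \<Rightarrow> bool" where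
  "lsd_embedding S m \<pi> T mT K mK eps \<psi> \<longleftrightarrow>
     left_action T mT K mK eps \<and> \<psi> ` S \<subseteq> lsd_carrier K T mT eps \<and> inj_on \<psi> S \<and>
     (\<forall>x\<in>S. \<forall>y\<in>S. \<psi> (m x y) = lsd_mult mK T mT eps (\<psi> x) (\<psi> y)) \<and> (\<forall>x\<in>S. snd (\<psi> x) = \<pi> x)"

lemma (in inverse_semigroup_on) lsd_embedding_transport:
  assumes emb: "lsd_embedding S mS \<pi> T (\<odot>) K mK eps \<psi>" and K: "semigroup K mK" and inj: "inj_on f K"
  shows "lsd_embedding S mS \<pi> T (\<odot>) (f ` K) (transport_mult f K mK)
    (\<lambda>t. f \<circ> eps t \<circ> inv_into K f) (map_prod f id \<circ> \<psi>)"
  unfolding lsd_embedding_def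
proof (intro conjI)
  have eps: "eps t k \<in> K" if "t \<in> T" "k \<in> K" for t k
    using emb that by (simp add: lsd_embedding_def left_action_def endomorphism_def)
  have \<psi>: "fst (\<psi> x) \<in> K" "snd (\<psi> x) \<in> T" "eps (snd (\<psi> x) \<odot> (snd (\<psi> x))\<inverse>) (fst (\<psi> x)) = fst (\<psi> x)"
    if "x \<in> S" for x
  proof -
    have "\<psi> x \<in> lsd_carrier K T (\<odot>) eps"
      using emb that by (auto simp: lsd_embedding_def)
    then show "fst (\<psi> x) \<in> K" "snd (\<psi> x) \<in> T"
      "eps (snd (\<psi> x) \<odot> (snd (\<psi> x))\<inverse>) (fst (\<psi> x)) = fst (\<psi> x)"
      by (auto simp: lsd_carrier_def)
  qed
  show "left_action T (\<odot>) (f ` K) (transport_mult f K mK) (\<lambda>t. f \<circ> eps t \<circ> inv_into K f)"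
    using emb K inj eps
    unfolding lsd_embedding_def left_action_def endomorphism_def
    by (auto simp: transport_mult_def semigroup_def)
  show "(map_prod f id \<circ> \<psi>) ` S \<subseteq> lsd_carrier (f ` K) T (\<odot>) (\<lambda>t. f \<circ> eps t \<circ> inv_into K f)"
    using \<psi> inj by (simp add: image_subset_iff lsd_carrier_def map_prod_def case_prod_beta)
  show "inj_on (map_prod f id \<circ> \<psi>) S"
    using emb inj \<psi>(1) by (auto simp: lsd_embedding_def inj_on_def prod_eq_iff)
  show "\<forall>x\<in>S. \<forall>y\<in>S. (map_prod f id \<circ> \<psi>) (mS x y) =
      lsd_mult (transport_mult f K mK) T (\<odot>) (\<lambda>t. f \<circ> eps t \<circ> inv_into K f)
        ((map_prod f id \<circ> \<psi>) x) ((map_prod f id \<circ> \<psi>) y)"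
    using emb inj \<psi> eps by (simp add: lsd_embedding_def lsd_mult_def transport_mult_def Let_def)
  show "\<forall>x\<in>S. snd ((map_prod f id \<circ> \<psi>) x) = \<pi> x"
    using emb by (simp add: lsd_embedding_def)
qed

locale arrow_representation = inverse_semigroup_on T m
  for T :: "'t set" and m :: "'t \<Rightarrow> 't \<Rightarrow> 't" (infixl "\<odot>" 70) +
  fixes S :: "'a set" and mS :: "'a \<Rightarrow> 'a \<Rightarrow> 'a" (infixl "\<cdot>" 70) and \<pi> :: "'a \<Rightarrow> 't"
    and L :: "'t \<Rightarrow> 'l set" and mL :: "'t \<Rightarrow> 'l \<Rightarrow> 'l \<Rightarrow> 'l" and c :: "'t \<Rightarrow> 'l" and \<phi> :: "'t \<Rightarrow> 'a \<Rightarrow> 'l"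
  assumes \<pi>_closed: "a \<in> S \<Longrightarrow> \<pi> a \<in> T"
    and \<pi>_mult: "a \<in> S \<Longrightarrow> b \<in> S \<Longrightarrow> \<pi> (a \<cdot> b) = \<pi> a \<odot> \<pi> b"
    and c_closed: "e \<in> idempotents T (\<odot>) \<Longrightarrow> c e \<in> L e"
    and c_idem: "e \<in> idempotents T (\<odot>) \<Longrightarrow> mL e (c e) (c e) = c e"
    and \<phi>_closed: "a \<in> S \<Longrightarrow> arrow z (\<pi> a) \<Longrightarrow> \<phi> z a \<in> L (left_unit z)"
    and \<phi>_mult: "a \<in> S \<Longrightarrow> b \<in> S \<Longrightarrow> arrow z (\<pi> a) \<Longrightarrow> arrow (z \<odot> \<pi> a) (\<pi> b) \<Longrightarrow>
      \<phi> z (a \<cdot> b) = mL (left_unit z) (\<phi> z a) (\<phi> (z \<odot> \<pi> a) b)"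
    and \<phi>_faithful: "a \<in> S \<Longrightarrow> b \<in> S \<Longrightarrow> \<pi> a = \<pi> b \<Longrightarrow>
      \<phi> (left_unit (\<pi> a)) a = \<phi> (left_unit (\<pi> a)) b \<Longrightarrow> a = b"
begin

definition K :: "('t \<Rightarrow> 'l) set" where
  "K = (\<Pi>\<^sub>E x\<in>T. L (left_unit x))"

definition mK :: "('t \<Rightarrow> 'l) \<Rightarrow> ('t \<Rightarrow> 'l) \<Rightarrow> 't \<Rightarrow> 'l" where
  "mK = pointwise T (\<lambda>x. mL (left_unit x))"

definition act :: "'t \<Rightarrow> ('t \<Rightarrow> 'l) \<Rightarrow> 't \<Rightarrow> 'l" where
  "act t f = (\<lambda>x\<in>T. if arrow x t then f (x \<odot> t) else c (left_unit x))"

definition \<psi> :: "'a \<Rightarrow> ('t \<Rightarrow> 'l) \<times> 't" where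
  "\<psi> a = ((\<lambda>x\<in>T. if arrow x (\<pi> a) then \<phi> x a else c (left_unit x)), \<pi> a)"

lemma left_action_K: "left_action T (\<odot>) K mK act"
  unfolding left_action_def endomorphism_def
proof (intro conjI ballI)
  fix t f assume t: "t \<in> T" and f: "f \<in> K"
  have target: "f (x \<odot> t) \<in> L (left_unit x)" if "x \<in> T" "arrow x t" for x
    using f that t PiE_mem[of f T "\<lambda>x. L (left_unit x)" "x \<odot> t"] left_unit_target
    by (simp add: K_def)
  then show "act t f \<in> K"
    by (auto simp: K_def act_def c_closed)
  fix g
  show "act t (mK f g) = mK (act t f) (act t g)"
    using t unfolding act_def mK_def pointwise_def
    by (auto simp: c_idem left_unit_target intro!: restrict_ext)
next
  fix t u f assume "t \<in> T" "u \<in> T"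
  then show "act (t \<odot> u) f = act t (act u f)"
    by (auto simp: act_def arrow_mult_iff left_unit_target intro!: restrict_ext)
qed

lemma \<psi>_in_lsd_carrier:
  assumes "a \<in> S"
  shows "\<psi> a \<in> lsd_carrier K T (\<odot>) act"
proof -
  have "fst (\<psi> a) \<in> K"
    using assms by (auto simp: \<psi>_def K_def \<phi>_closed c_closed)
  moreover have "act (left_unit (\<pi> a)) (fst (\<psi> a)) = fst (\<psi> a)"
    using \<pi>_closed[OF assms]
    by (auto simp: act_def \<psi>_def arrow_left_unit_iff arrow_def intro!: restrict_ext)
  ultimately show ?thesis
    using \<pi>_closed[OF assms] by (simp add: lsd_carrier_def \<psi>_def left_unit_def)
qed

lemma \<psi>_mult:
  assumes S: "a \<in> S" "b \<in> S"
  shows "\<psi> (a \<cdot> b) = lsd_mult mK T (\<odot>) act (\<psi> a) (\<psi> b)"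
proof -
  have T: "\<pi> a \<in> T" "\<pi> b \<in> T"
    using S by (simp_all add: \<pi>_closed)
  let ?u = "left_unit (\<pi> a \<odot> \<pi> b)"
  have "mK (act ?u (fst (\<psi> a))) (act (\<pi> a) (fst (\<psi> b))) x = fst (\<psi> (a \<cdot> b)) x" if x: "x \<in> T" for x
  proof (cases "arrow x (\<pi> a \<odot> \<pi> b)")
    case True
    then have "arrow x ?u" "x \<odot> ?u = x" "arrow x (\<pi> a)" "arrow (x \<odot> \<pi> a) (\<pi> b)"
      using T x arrow_mult_iff[OF x T] by (simp_all add: arrow_left_unit_iff) (simp add: arrow_def)
    then show ?thesis
      using True S T x by (simp add: mK_def pointwise_def act_def \<psi>_def \<pi>_mult \<phi>_mult)
  next
    case False
    then have "act ?u (fst (\<psi> a)) x = c (left_unit x)" "act (\<pi> a) (fst (\<psi> b)) x = c (left_unit x)"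
      using T x by (auto simp: act_def \<psi>_def arrow_left_unit_iff arrow_mult_iff left_unit_target)
    then show ?thesis
      using False S x by (simp add: mK_def pointwise_def \<psi>_def \<pi>_mult c_idem)
  qed
  then have "mK (act ?u (fst (\<psi> a))) (act (\<pi> a) (fst (\<psi> b))) = fst (\<psi> (a \<cdot> b))"
    by (auto simp: mK_def pointwise_def \<psi>_def)
  then show ?thesis
    using S by (simp add: lsd_mult_def Let_def prod_eq_iff \<psi>_def \<pi>_mult left_unit_def)
qed

lemma inj_on_\<psi>: "inj_on \<psi> S"
proof (rule inj_onI)
  fix a b assume S: "a \<in> S" "b \<in> S" and eq: "\<psi> a = \<psi> b"
  let ?z = "left_unit (\<pi> a)"
  have \<pi>: "\<pi> b = \<pi> a"
    using eq by (simp add: \<psi>_def)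
  have "fst (\<psi> a) ?z = fst (\<psi> b) ?z"
    by (simp only: eq)
  then have "\<phi> ?z a = \<phi> ?z b"
    using \<pi> \<pi>_closed[OF S(1)] by (simp add: \<psi>_def arrow_left_unit_source)
  then show "a = b"
    using S \<pi> by (intro \<phi>_faithful) simp_all
qed

lemma lsd_embedding_\<psi>: "lsd_embedding S (\<cdot>) \<pi> T (\<odot>) K mK act \<psi>"
  unfolding lsd_embedding_def
  using left_action_K \<psi>_in_lsd_carrier \<psi>_mult inj_on_\<psi> by (auto simp: \<psi>_def)

end

section \<open>Locally inverse semigroups\<close>

locale locally_commuting_idempotents = semigroup_on S m
  for S :: "'a set" and m :: "'a \<Rightarrow> 'a \<Rightarrow> 'a" (infixl "\<cdot>" 70) +
  assumes local_commute: "f \<in> S \<Longrightarrow> f \<cdot> f = f \<Longrightarrow> g \<in> S \<Longrightarrow> g \<cdot> g = g \<Longrightarrow> h \<in> S \<Longrightarrow> h \<cdot> h = h \<Longrightarrow>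
    f \<cdot> g = g \<Longrightarrow> g \<cdot> f = g \<Longrightarrow> f \<cdot> h = h \<Longrightarrow> h \<cdot> f = h \<Longrightarrow> g \<cdot> h = h \<cdot> g"
begin

lemma opposite: "locally_commuting_idempotents S (\<lambda>x y. y \<cdot> x)"
  by unfold_locales (auto simp: semigroup_def intro: local_commute[symmetric])

text \<open>The idempotents \<open>f s v\<close> and \<open>f s v'\<close> lie in \<open>f S f\<close> and are \<open>\<R>\<close>-related, hence equal.\<close>

lemma outer_inverse_unique_right:
  assumes f: "f \<in> S" "f \<cdot> f = f" and s: "s \<in> S"
    and v: "v \<in> S" "v \<cdot> s \<cdot> v = v" "v \<cdot> f = v" and v': "v' \<in> S" "v' \<cdot> s \<cdot> v' = v'" "v' \<cdot> f = v'"
    and eq: "v \<cdot> s = v' \<cdot> s"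
  shows "v = v'"
proof -
  define g h where "g = f \<cdot> (s \<cdot> v)" and "h = f \<cdot> (s \<cdot> v')"
  have S: "g \<in> S" "h \<in> S"
    using f s v v' by (simp_all add: g_def h_def)
  have vsv: "v \<cdot> (s \<cdot> v) = v" "v \<cdot> (s \<cdot> v') = v'" "v' \<cdot> (s \<cdot> v) = v" "v' \<cdot> (s \<cdot> v') = v'"
    using eq s v v' by (metis assoc)+
  have mult: "g \<cdot> g = g" "h \<cdot> h = h" "g \<cdot> h = h" "h \<cdot> g = g"
    using f s v(1,3) v'(1,3) by (simp_all add: g_def h_def right_absorb vsv)
  have "f \<cdot> g = g" "g \<cdot> f = g" "f \<cdot> h = h" "h \<cdot> f = h"
    using f s v v' by (simp_all add: g_def h_def left_absorb)
  then have "g \<cdot> h = h \<cdot> g"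
    using local_commute[OF f S(1) mult(1) S(2) mult(2)] by simp
  then have "v \<cdot> g = v \<cdot> h"
    using mult by simp
  then show ?thesis
    using f s v(1,3) v'(1,3) by (simp add: g_def h_def right_absorb vsv)
qed

lemma outer_inverse_unique_left:
  assumes "f \<in> S" "f \<cdot> f = f" "s \<in> S"
    and "w \<in> S" "w \<cdot> (s \<cdot> w) = w" "f \<cdot> w = w" and "w' \<in> S" "w' \<cdot> (s \<cdot> w') = w'" "f \<cdot> w' = w'"
    and "s \<cdot> w = s \<cdot> w'"
  shows "w = w'"
proof (rule locally_commuting_idempotents.outer_inverse_unique_right[OF opposite, of f s])
qed (use assms in simp_all)

end

locale locally_inverse_on =
  fixes S :: "'a set" and m :: "'a \<Rightarrow> 'a \<Rightarrow> 'a" (infixl "\<cdot>" 70)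
  assumes locally_inverse: "locally_inverse S (\<cdot>)"
begin

sublocale locally_commuting_idempotents S "(\<cdot>)"
proof unfold_locales
  show "semigroup S (\<cdot>)"
    using locally_inverse by (simp add: locally_inverse_def regular_def)
next
  fix f g h
  assume f: "f \<in> S" "f \<cdot> f = f" and g: "g \<in> S" "g \<cdot> g = g" "f \<cdot> g = g" "g \<cdot> f = g"
    and h: "h \<in> S" "h \<cdot> h = h" "f \<cdot> h = h" "h \<cdot> f = h"
  interpret fSf: inverse_semigroup_on "local_submonoid S (\<cdot>) f" "(\<cdot>)"
    using locally_inverse f
    by unfold_locales (simp add: locally_inverse_def idempotents_def idem_def)
  have "g \<in> local_submonoid S (\<cdot>) f" "h \<in> local_submonoid S (\<cdot>) f"
    unfolding local_submonoid_def using g h by force+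
  then show "g \<cdot> h = h \<cdot> g"
    using g h by (intro fSf.idempotent_commute)
qed

lemma inverse_exists:
  assumes a: "a \<in> S"
  obtains b where "b \<in> S" "a \<cdot> (b \<cdot> a) = a" "b \<cdot> (a \<cdot> b) = b"
proof -
  obtain x where x: "x \<in> S" "a \<cdot> (x \<cdot> a) = a"
    using locally_inverse a by (auto simp: locally_inverse_def regular_def)
  have "a \<cdot> (x \<cdot> (a \<cdot> z)) = a \<cdot> z" if "z \<in> S" for z
    using x a that by (metis assoc closed)
  then show thesis
    using that[of "x \<cdot> (a \<cdot> x)"] x a by simp
qed

end

section \<open>Extensions with completely simple idempotent classes\<close>

locale completely_simple_extension =
  T: inverse_semigroup_on T mT + S: locally_inverse_on S m
  for T :: "'t set" and mT :: "'t \<Rightarrow> 't \<Rightarrow> 't" (infixl "\<odot>" 70)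
    and S :: "'a set" and m :: "'a \<Rightarrow> 'a \<Rightarrow> 'a" (infixl "\<cdot>" 70) +
  fixes \<pi> :: "'a \<Rightarrow> 't"
  assumes surj: "\<pi> ` S = T"
    and hom [simp]: "x \<in> S \<Longrightarrow> y \<in> S \<Longrightarrow> \<pi> (x \<cdot> y) = \<pi> x \<odot> \<pi> y"
    and class_completely_simple: "k \<in> idempotents S (\<cdot>) \<Longrightarrow> completely_simple {x \<in> S. \<pi> x = \<pi> k} (\<cdot>)"
begin

notation T.inverse ("_\<inverse>" [1000] 999)

lemma \<pi>_closed [simp]: "x \<in> S \<Longrightarrow> \<pi> x \<in> T"
  using surj by blast

lemma inverse_over:
  assumes a: "a \<in> S"
  obtains b where "b \<in> S" "a \<cdot> (b \<cdot> a) = a" "b \<cdot> (a \<cdot> b) = b" "\<pi> b = (\<pi> a)\<inverse>"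
proof -
  obtain b where b: "b \<in> S" "a \<cdot> (b \<cdot> a) = a" "b \<cdot> (a \<cdot> b) = b"
    using S.inverse_exists[OF a] .
  have "\<pi> a \<odot> (\<pi> b \<odot> \<pi> a) = \<pi> a" "\<pi> b \<odot> (\<pi> a \<odot> \<pi> b) = \<pi> b"
    using a b by (metis S.closed hom)+
  then have "\<pi> b = (\<pi> a)\<inverse>"
    using a b(1) by (intro T.inverse_eqI[symmetric]) simp_all
  with b that show thesis
    by blast
qed

lemma idempotent_lift:
  assumes e: "e \<in> idempotents T (\<odot>)"
  shows "\<exists>k. k \<in> idempotents S (\<cdot>) \<and> \<pi> k = e"
proof -
  have eT: "e \<in> T" "e \<odot> e = e"
    using e by (simp_all add: idempotents_def idem_def)
  obtain a where a: "a \<in> S" "\<pi> a = e"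
    using eT(1) surj by blast
  obtain x where x: "x \<in> S" "a \<cdot> a \<cdot> (x \<cdot> (a \<cdot> a)) = a \<cdot> a" "x \<cdot> (a \<cdot> a \<cdot> x) = x"
    using S.inverse_exists[of "a \<cdot> a"] a by auto
  let ?k = "a \<cdot> (x \<cdot> a)"
  have "?k \<cdot> ?k = a \<cdot> (x \<cdot> (a \<cdot> a \<cdot> x)) \<cdot> a"
    using a x(1) by simp
  also have "\<dots> = ?k"
    unfolding x(3) using a x(1) by simp
  finally have "?k \<cdot> ?k = ?k" .
  moreover have "\<pi> ?k = e"
  proof -
    have "\<pi> ?k = \<pi> (a \<cdot> a \<cdot> (x \<cdot> (a \<cdot> a)))"
      using a x(1) eT by (simp add: T.left_absorb)
    then show ?thesis
      using x(2) a eT by simp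
  qed
  ultimately show ?thesis
    using a x(1) by (intro exI[of _ ?k]) (simp add: idempotents_def idem_def)
qed

lemma idempotent_absorb:
  assumes i: "i \<in> S" "i \<cdot> i = i" and g: "g \<in> S" "g \<cdot> g = g" and \<pi>: "\<pi> i = \<pi> g" and gi: "g \<cdot> i = i"
  shows "i \<cdot> g = g"
proof -
  have "completely_simple {x \<in> S. \<pi> x = \<pi> g} (\<cdot>)"
    using g by (intro class_completely_simple) (simp add: idempotents_def idem_def)
  then obtain x where x: "x \<in> S" "g \<cdot> (i \<cdot> x) = g"
    using i g \<pi> unfolding completely_simple_iff by blast
  then have "i \<cdot> x = g"
    using i g gi by (metis S.assoc)
  then show ?thesis
    using i x by (metis S.assoc)
qed

definition base :: "'t \<Rightarrow> 'a" where
  "base e = (SOME k. k \<in> idempotents S (\<cdot>) \<and> \<pi> k = e)"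

lemma base_idempotent_over:
  assumes "e \<in> idempotents T (\<odot>)"
  shows "base e \<in> S" "base e \<cdot> base e = base e" "\<pi> (base e) = e"
  using someI_ex[OF idempotent_lift[OF assms]] by (auto simp: base_def idempotents_def idem_def)

definition vertex_group :: "'t \<Rightarrow> 'a monoid" where
  "vertex_group e = local_group {x \<in> S. \<pi> x = e} (\<cdot>) (base e)"

lemma vertex_group_mult [simp]: "x \<otimes>\<^bsub>vertex_group e\<^esub> y = x \<cdot> y"
  and vertex_group_one [simp]: "\<one>\<^bsub>vertex_group e\<^esub> = base e"
  and carrier_vertex_group: "carrier (vertex_group e) =
    {x \<in> S. \<pi> x = e \<and> base e \<cdot> x = x \<and> x \<cdot> base e = x}"
  by (auto simp: vertex_group_def local_group_def)

lemma base_in_vertex_group: "e \<in> idempotents T (\<odot>) \<Longrightarrow> base e \<in> carrier (vertex_group e)"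
  by (simp add: carrier_vertex_group base_idempotent_over)

lemma group_vertex_group:
  assumes "e \<in> idempotents T (\<odot>)"
  shows "group (vertex_group e)"
  unfolding vertex_group_def
proof (rule group_local_group)
  note base = base_idempotent_over[OF assms]
  show "completely_simple {x \<in> S. \<pi> x = e} (\<cdot>)"
    using class_completely_simple[of "base e"] base by (simp add: idempotents_def idem_def)
  show "base e \<in> idempotents {x \<in> S. \<pi> x = e} (\<cdot>)"
    using base by (simp add: idempotents_def idem_def)
qed

definition outward :: "'t \<Rightarrow> 'a" where
  "outward z = base (T.left_unit z) \<cdot> inv_into S \<pi> z"

definition inward :: "'t \<Rightarrow> 'a" where
  "inward z = inv_into S \<pi> (z\<inverse>) \<cdot> base (T.left_unit z)"

lemma inv_into_over: "t \<in> T \<Longrightarrow> inv_into S \<pi> t \<in> S" "t \<in> T \<Longrightarrow> \<pi> (inv_into S \<pi> t) = t"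
  using surj by (auto intro: inv_into_into f_inv_into_f)

lemma outward_over:
  assumes "z \<in> T"
  shows "outward z \<in> S" "\<pi> (outward z) = z" "base (T.left_unit z) \<cdot> outward z = outward z"
  using assms by (simp_all add: outward_def inv_into_over base_idempotent_over S.left_absorb)

lemma inward_over:
  assumes "z \<in> T"
  shows "inward z \<in> S" "\<pi> (inward z) = z\<inverse>" "inward z \<cdot> base (T.left_unit z) = inward z"
  using assms by (simp_all add: inward_def inv_into_over base_idempotent_over)

definition loop :: "'t \<Rightarrow> 'a \<Rightarrow> 'a" where
  "loop z a = outward z \<cdot> (a \<cdot> inward (z \<odot> \<pi> a))"

definition inv_loop :: "'t \<Rightarrow> 'a \<Rightarrow> 'a" where
  "inv_loop z a = inv\<^bsub>vertex_group (T.left_unit z)\<^esub> loop z a"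

definition row :: "'t \<Rightarrow> 'a \<Rightarrow> 'a" where
  "row z a = a \<cdot> (inward (z \<odot> \<pi> a) \<cdot> inv_loop z a)"

definition col :: "'t \<Rightarrow> 'a \<Rightarrow> 'a" where
  "col z a = inv_loop z a \<cdot> (outward z \<cdot> a)"

context
  fixes z a
  assumes arrow: "T.arrow z (\<pi> a)" and a: "a \<in> S"
begin

lemma arrow_objects:
  shows "z \<in> T" "z \<odot> \<pi> a \<in> T" "T.left_unit (z \<odot> \<pi> a) = T.left_unit z"
    and "\<pi> a \<odot> (z \<odot> \<pi> a)\<inverse> = z\<inverse>"
  using arrow a T.left_unit_target T.mult_inverse_target by (simp_all add: T.arrow_def)

lemmas outward_source = outward_over[OF arrow_objects(1)]
  and inward_target = inward_over[OF arrow_objects(2), unfolded arrow_objects(3)]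
  and base_component = base_idempotent_over[OF T.left_unit_idempotents[OF arrow_objects(1)]]

lemma loop_in_vertex_group: "loop z a \<in> carrier (vertex_group (T.left_unit z))"
proof -
  have "\<pi> (loop z a) = T.left_unit z"
    using outward_source inward_target a arrow_objects by (simp add: loop_def T.left_unit_def)
  then show ?thesis
    using outward_source inward_target base_component a
    by (simp add: carrier_vertex_group loop_def S.left_absorb)
qed

lemma inv_loop_in_vertex_group: "inv_loop z a \<in> carrier (vertex_group (T.left_unit z))"
  and inv_loop_loop: "inv_loop z a \<cdot> loop z a = base (T.left_unit z)"
  and loop_inv_loop: "loop z a \<cdot> inv_loop z a = base (T.left_unit z)"
proof -
  interpret group "vertex_group (T.left_unit z)"
    using arrow_objects(1) by (simp add: group_vertex_group)
  show "inv_loop z a \<in> carrier (vertex_group (T.left_unit z))"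
    "inv_loop z a \<cdot> loop z a = base (T.left_unit z)"
    "loop z a \<cdot> inv_loop z a = base (T.left_unit z)"
    using loop_in_vertex_group l_inv r_inv by (auto simp: inv_loop_def)
qed

lemma loop_over: "loop z a \<in> S"
  and inv_loop_over: "inv_loop z a \<in> S" "\<pi> (inv_loop z a) = T.left_unit z"
    "base (T.left_unit z) \<cdot> inv_loop z a = inv_loop z a"
    "inv_loop z a \<cdot> base (T.left_unit z) = inv_loop z a"
  using loop_in_vertex_group inv_loop_in_vertex_group by (simp_all add: carrier_vertex_group)

lemma row_over: "row z a \<in> S" "\<pi> (row z a) = z\<inverse>" "row z a \<cdot> base (T.left_unit z) = row z a"
proof -
  show "row z a \<in> S" "row z a \<cdot> base (T.left_unit z) = row z a"
    using inv_loop_over inward_target base_component a by (simp_all add: row_def)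
  have "\<pi> (row z a) = \<pi> a \<odot> (z \<odot> \<pi> a)\<inverse> \<odot> T.left_unit z"
    using inv_loop_over inward_target a arrow_objects(1,2) by (simp add: row_def)
  then show "\<pi> (row z a) = z\<inverse>"
    by (simp only: arrow_objects T.inverse_mult_left_unit)
qed

lemma col_over: "col z a \<in> S" "\<pi> (col z a) = z \<odot> \<pi> a" "base (T.left_unit z) \<cdot> col z a = col z a"
proof -
  show "col z a \<in> S" "base (T.left_unit z) \<cdot> col z a = col z a"
    using inv_loop_over outward_source base_component a by (simp_all add: col_def S.left_absorb)
  have "\<pi> (col z a) = T.left_unit z \<odot> z \<odot> \<pi> a"
    using inv_loop_over outward_source a arrow_objects(1,2)
    by (simp add: col_def del: T.left_unit_mult)
  then show "\<pi> (col z a) = z \<odot> \<pi> a"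
    by (simp only: arrow_objects T.left_unit_mult)
qed

lemma row_factor: "\<exists>x\<in>S. row z a = a \<cdot> x"
  using inv_loop_over(1) inward_target(1)
  by (intro bexI[of _ "inward (z \<odot> \<pi> a) \<cdot> inv_loop z a"]) (simp_all add: row_def)

lemma col_factor: "\<exists>x\<in>S. col z a = x \<cdot> a"
  using inv_loop_over(1) outward_source(1) a
  by (intro bexI[of _ "inv_loop z a \<cdot> outward z"]) (simp_all add: col_def)

lemma outward_row: "outward z \<cdot> row z a = base (T.left_unit z)"
  using loop_inv_loop inv_loop_over outward_source inward_target a by (simp add: row_def loop_def)

lemma col_inward: "col z a \<cdot> inward (z \<odot> \<pi> a) = base (T.left_unit z)"
  using inv_loop_loop inv_loop_over outward_source inward_target a by (simp add: col_def loop_def)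

lemma row_loop: "row z a \<cdot> loop z a = a \<cdot> inward (z \<odot> \<pi> a)"
  using inv_loop_loop inv_loop_over loop_over inward_target a by (simp add: row_def)

lemma loop_col: "loop z a \<cdot> col z a = outward z \<cdot> a"
proof -
  have "loop z a \<cdot> col z a = loop z a \<cdot> inv_loop z a \<cdot> (outward z \<cdot> a)"
    using inv_loop_over(1) loop_over outward_source(1) a by (simp add: col_def)
  then show ?thesis
    using loop_inv_loop outward_source base_component a by (simp add: S.left_absorb)
qed

end

context
  fixes z a b
  assumes a: "a \<in> S" and b: "b \<in> S"
    and arrow_a: "T.arrow z (\<pi> a)" and arrow_b: "T.arrow (z \<odot> \<pi> a) (\<pi> b)"
begin

lemma arrow_mult: "T.arrow z (\<pi> (a \<cdot> b))"
  using arrow_a arrow_b a b by (simp add: T.arrow_mult_iff T.arrow_def[of z "\<pi> a"])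

lemma row_mult: "row z (a \<cdot> b) = row z a"
proof -
  note row_a = row_over[OF arrow_a a] outward_row[OF arrow_a a]
    and row_ab = row_over[OF arrow_mult S.closed[OF a b]]
      outward_row[OF arrow_mult S.closed[OF a b]]
  obtain a' where a': "a' \<in> S" "a \<cdot> (a' \<cdot> a) = a"
    using S.inverse_exists[OF a] .
  have absorb: "a \<cdot> a' \<cdot> (a \<cdot> x) = a \<cdot> x" if "x \<in> S" for x
    using a' a that by (metis S.assoc S.closed)
  show ?thesis
  proof (rule S.outer_inverse_unique_left[of "a \<cdot> a'" "outward z"])
    show "a \<cdot> a' \<cdot> (a \<cdot> a') = a \<cdot> a'"
      using absorb a' by blast
    show "a \<cdot> a' \<cdot> row z (a \<cdot> b) = row z (a \<cdot> b)"
      using row_factor[OF arrow_mult S.closed[OF a b]] absorb a b by (metis S.assoc S.closed)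
    show "a \<cdot> a' \<cdot> row z a = row z a"
      using row_factor[OF arrow_a a] absorb by metis
  qed (use a a'(1) outward_source(1)[OF arrow_a a] in \<open>simp_all only: S.closed row_a row_ab\<close>)
qed

lemma col_mult: "col z (a \<cdot> b) = col (z \<odot> \<pi> a) b"
proof -
  note z = arrow_objects[OF arrow_a a]
  have target: "z \<odot> \<pi> (a \<cdot> b) = z \<odot> \<pi> a \<odot> \<pi> b"
    using a b z by simp
  note col_b = col_over[OF arrow_b b, unfolded z(3)] col_inward[OF arrow_b b, unfolded z(3)]
    and col_ab = col_over[OF arrow_mult S.closed[OF a b]]
      col_inward[OF arrow_mult S.closed[OF a b], unfolded target]
  obtain b' where b': "b' \<in> S" "b \<cdot> (b' \<cdot> b) = b"
    using S.inverse_exists[OF b] .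
  have absorb: "x \<cdot> b \<cdot> (b' \<cdot> b) = x \<cdot> b" if "x \<in> S" for x
    using b' b that by simp
  show ?thesis
  proof (rule S.outer_inverse_unique_right[of "b' \<cdot> b" "inward (z \<odot> \<pi> a \<odot> \<pi> b)"])
    show "b' \<cdot> b \<cdot> (b' \<cdot> b) = b' \<cdot> b"
      using absorb b' by blast
    show "col z (a \<cdot> b) \<cdot> (b' \<cdot> b) = col z (a \<cdot> b)"
      using col_factor[OF arrow_mult S.closed[OF a b]] absorb a b by (metis S.assoc S.closed)
    show "col (z \<odot> \<pi> a) b \<cdot> (b' \<cdot> b) = col (z \<odot> \<pi> a) b"
      using col_factor[OF arrow_b b] absorb by metis
  qed (use b b'(1) inward_target(1)[OF arrow_b b] in \<open>simp_all only: S.closed col_b col_ab\<close>)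
qed

lemma col_row_in_vertex_group:
  "col z a \<cdot> row (z \<odot> \<pi> a) b \<in> carrier (vertex_group (T.left_unit z))"
proof -
  note z = arrow_objects[OF arrow_a a]
  note col = col_over[OF arrow_a a] and row = row_over[OF arrow_b b, unfolded z(3)]
  have "\<pi> (col z a \<cdot> row (z \<odot> \<pi> a) b) = T.left_unit z"
    using col row a z by (simp add: T.left_unit_def)
  then show ?thesis
    using col row base_component(1)[OF arrow_a a] by (simp add: carrier_vertex_group S.left_absorb)
qed

lemma loop_mult:
  "loop z (a \<cdot> b) = loop z a \<cdot> (col z a \<cdot> row (z \<odot> \<pi> a) b) \<cdot> loop (z \<odot> \<pi> a) b"
proof -
  have "loop z (a \<cdot> b) = (outward z \<cdot> a) \<cdot> (b \<cdot> inward (z \<odot> \<pi> a \<odot> \<pi> b))"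
    using a b arrow_objects(1)[OF arrow_a a] outward_source(1)[OF arrow_a a]
      inward_target(1)[OF arrow_b b] by (simp add: loop_def)
  also have "\<dots> = (loop z a \<cdot> col z a) \<cdot> (row (z \<odot> \<pi> a) b \<cdot> loop (z \<odot> \<pi> a) b)"
    by (simp only: loop_col[OF arrow_a a] row_loop[OF arrow_b b])
  finally show ?thesis
    using loop_over[OF arrow_a a] loop_over[OF arrow_b b] col_over(1)[OF arrow_a a]
      row_over(1)[OF arrow_b b] by simp
qed

end

lemma row_loop_col:
  assumes a: "a \<in> S"
  defines "z \<equiv> T.left_unit (\<pi> a)"
  shows "row z a \<cdot> (loop z a \<cdot> col z a) = a"
proof -
  have arrow: "T.arrow z (\<pi> a)"
    using a by (simp add: z_def T.arrow_left_unit_source)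
  note row = row_over[OF arrow a] and out = outward_source[OF arrow a]
  have z: "z \<in> T" "z\<inverse> = z" "z \<odot> z = z"
    using a by (simp_all add: z_def T.inverse_idempotent)
  obtain a' where a': "a' \<in> S" "a \<cdot> (a' \<cdot> a) = a" "a' \<cdot> (a \<cdot> a') = a'" "\<pi> a' = (\<pi> a)\<inverse>"
    using inverse_over[OF a] .
  let ?i = "row z a \<cdot> outward z"
  have "?i \<cdot> (a \<cdot> a') = a \<cdot> a'"
  proof (rule idempotent_absorb)
    have "?i \<cdot> ?i = row z a \<cdot> (outward z \<cdot> row z a) \<cdot> outward z"
      using row(1) out(1) by simp
    then show "?i \<cdot> ?i = ?i"
      using row out outward_row[OF arrow a] by simp
    show "\<pi> ?i = \<pi> (a \<cdot> a')"
      using row out a a' z by (simp add: z_def T.left_unit_def)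
    obtain x where "x \<in> S" "row z a = a \<cdot> x"
      using row_factor[OF arrow a] by blast
    then show "a \<cdot> a' \<cdot> ?i = ?i"
      using out(1) a a' by (metis S.assoc S.closed)
  qed (use row out a a' in simp_all)
  then have "?i \<cdot> (a \<cdot> a') \<cdot> a = a \<cdot> a' \<cdot> a"
    by simp
  then have "row z a \<cdot> (outward z \<cdot> a) = a"
    using row(1) out(1) a a' by simp
  then show ?thesis
    by (simp only: loop_col[OF arrow a])
qed

text \<open>The entry at \<open>(v, w)\<close> only matters for \<open>v\<close> and \<open>w\<close> coming from composable arrows; then the
  product lies in the vertex group, and the value elsewhere is arbitrary.\<close>

definition sandwich :: "'t \<Rightarrow> 'a \<Rightarrow> 'a \<Rightarrow> 'a" where
  "sandwich e v w = (if v \<cdot> w \<in> carrier (vertex_group e) then v \<cdot> w else base e)"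

sublocale rees: arrow_representation T "(\<odot>)" S "(\<cdot>)" \<pi>
  "\<lambda>e. S \<times> carrier (vertex_group e) \<times> S" "\<lambda>e. rees_mult (vertex_group e) (sandwich e)"
  "\<lambda>e. (base e, base e, base e)" "\<lambda>z a. (row z a, loop z a, col z a)"
proof unfold_locales
  fix e assume e: "e \<in> idempotents T (\<odot>)"
  show "(base e, base e, base e) \<in> S \<times> carrier (vertex_group e) \<times> S"
    using base_idempotent_over[OF e] base_in_vertex_group[OF e] by simp
  show "rees_mult (vertex_group e) (sandwich e) (base e, base e, base e) (base e, base e, base e) =
      (base e, base e, base e)"
    using base_idempotent_over[OF e] by (simp add: rees_mult_def sandwich_def)
next
  fix a z assume "a \<in> S" "T.arrow z (\<pi> a)"
  then show "(row z a, loop z a, col z a) \<in> S \<times> carrier (vertex_group (T.left_unit z)) \<times> S"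
    by (simp add: row_over col_over loop_in_vertex_group)
next
  fix a b z assume "a \<in> S" "b \<in> S" "T.arrow z (\<pi> a)" "T.arrow (z \<odot> \<pi> a) (\<pi> b)"
  then show "(row z (a \<cdot> b), loop z (a \<cdot> b), col z (a \<cdot> b)) =
      rees_mult (vertex_group (T.left_unit z)) (sandwich (T.left_unit z))
        (row z a, loop z a, col z a) (row (z \<odot> \<pi> a) b, loop (z \<odot> \<pi> a) b, col (z \<odot> \<pi> a) b)"
    by (simp add: rees_mult_def sandwich_def row_mult col_mult loop_mult col_row_in_vertex_group)
next
  fix a b
  assume "a \<in> S" "b \<in> S" "\<pi> a = \<pi> b" and
    "(row (T.left_unit (\<pi> a)) a, loop (T.left_unit (\<pi> a)) a, col (T.left_unit (\<pi> a)) a) =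
      (row (T.left_unit (\<pi> a)) b, loop (T.left_unit (\<pi> a)) b, col (T.left_unit (\<pi> a)) b)"
  then show "a = b"
    by (metis prod.inject row_loop_col)
qed simp_all

lemma completely_simple_K: "completely_simple rees.K rees.mK"
  unfolding rees.K_def rees.mK_def
proof (rule completely_simple_PiE, rule group.completely_simple_rees)
  fix x assume x: "x \<in> T"
  show "group (vertex_group (T.left_unit x))"
    using x by (simp add: group_vertex_group)
  show "S \<noteq> {}" "S \<noteq> {}"
    using x surj by auto
  show "sandwich (T.left_unit x) v w \<in> carrier (vertex_group (T.left_unit x))" for v w
    using x by (simp add: sandwich_def base_in_vertex_group)
qed

definition encode :: "('t \<Rightarrow> 'a \<times> 'a \<times> 'a) \<Rightarrow> 'a list set" where
  "encode f = (\<lambda>s. case f (\<pi> s) of (w, n, v) \<Rightarrow> [s, w, n, v]) ` S"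

lemma inj_on_encode: "inj_on encode rees.K"
proof (rule inj_onI)
  fix f g assume K: "f \<in> rees.K" "g \<in> rees.K" and eq: "encode f = encode g"
  have "f (\<pi> s) = g (\<pi> s)" if s: "s \<in> S" for s
  proof -
    obtain w n v where f: "f (\<pi> s) = (w, n, v)"
      by (cases "f (\<pi> s)")
    then have "[s, w, n, v] \<in> encode f"
      unfolding encode_def using s by force
    then have "[s, w, n, v] \<in> encode g"
      by (simp only: eq)
    then show ?thesis
      using f by (auto simp: encode_def split: prod.splits)
  qed
  then show "f = g"
    using K surj by (intro PiE_ext[of f T]) (auto simp: rees.K_def)
qed

lemma lsd_embedding_list_set:
  obtains K :: "'a list set set" and mK eps \<psi>
  where "completely_simple K mK" "lsd_embedding S (\<cdot>) \<pi> T (\<odot>) K mK eps \<psi>"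
proof
  show "completely_simple (encode ` rees.K) (transport_mult encode rees.K rees.mK)"
    using completely_simple_K inj_on_encode by (rule completely_simple_transport)
  show "lsd_embedding S (\<cdot>) \<pi> T (\<odot>) (encode ` rees.K) (transport_mult encode rees.K rees.mK)
      (\<lambda>t. encode \<circ> rees.act t \<circ> inv_into rees.K encode) (map_prod encode id \<circ> rees.\<psi>)"
    using completely_simple_K inj_on_encode
    by (intro T.lsd_embedding_transport rees.lsd_embedding_\<psi>) (simp_all add: completely_simple_iff)
qed

end

section \<open>Quotients by inverse semigroup congruences\<close>

lemma quot_mult_class:
  assumes r: "congruence S m r" and S: "x \<in> S" "y \<in> S"
  shows "quot_mult r m (r `` {x}) (r `` {y}) = r `` {m x y}"
proof -
  have equiv: "equiv S r"
    and cong: "(a, b) \<in> r \<Longrightarrow> c \<in> S \<Longrightarrow> (m c a, m c b) \<in> r \<and> (m a c, m b c) \<in> r" for a b c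
    using r by (auto simp: congruence_def)
  define x' y' where "x' = (SOME x'. x' \<in> r `` {x})" and "y' = (SOME y'. y' \<in> r `` {y})"
  have "x' \<in> r `` {x}" "y' \<in> r `` {y}"
    unfolding x'_def y'_def using equiv_class_self[OF equiv] S by (metis someI)+
  then have "(x, x') \<in> r" "(y, y') \<in> r"
    by simp_all
  moreover have "x' \<in> S"
    using \<open>(x, x') \<in> r\<close> equiv by (auto simp: equiv_def refl_on_def)
  ultimately have "(m x y, m x' y) \<in> r" "(m x' y, m x' y') \<in> r"
    using cong S by blast+
  then have "r `` {m x y} = r `` {m x' y'}"
    using equiv by (metis equiv_class_eq)
  then show ?thesis
    by (simp add: quot_mult_def x'_def y'_def)
qed

lemma completely_simple_extension_quotient:
  assumes li: "locally_inverse S m" and ic: "inverse_congruence S m \<rho>"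
    and cs: "\<forall>e\<in>idempotents S m. completely_simple (\<rho> `` {e}) m"
  shows "completely_simple_extension (S // \<rho>) (quot_mult \<rho> m) S m (\<lambda>x. \<rho> `` {x})"
proof unfold_locales
  have cong: "congruence S m \<rho>" and equiv: "equiv S \<rho>"
    using ic by (simp_all add: inverse_congruence_def congruence_def)
  show "inverse_semigroup (S // \<rho>) (quot_mult \<rho> m)"
    using ic by (simp add: inverse_congruence_def)
  show "locally_inverse S m"
    by (fact li)
  show "(\<lambda>x. \<rho> `` {x}) ` S = S // \<rho>"
    by (auto simp: quotient_def)
  show "\<rho> `` {m x y} = quot_mult \<rho> m (\<rho> `` {x}) (\<rho> `` {y})" if "x \<in> S" "y \<in> S" for x y
    using quot_mult_class[OF cong that] by simp
  show "completely_simple {x \<in> S. \<rho> `` {x} = \<rho> `` {k}} m" if k: "k \<in> idempotents S m" for k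
  proof -
    have "x \<in> S \<and> \<rho> `` {x} = \<rho> `` {k} \<longleftrightarrow> x \<in> \<rho> `` {k}" for x
      using k equiv_class_eq_iff[OF equiv, of k x] by (auto simp: idempotents_def)
    then have "{x \<in> S. \<rho> `` {x} = \<rho> `` {k}} = \<rho> `` {k}"
      by blast
    then show ?thesis
      using cs k by simp
  qed
qed

theorem theorem3p1:
  fixes S :: "'a set" and m :: "'a \<Rightarrow> 'a \<Rightarrow> 'a" and \<rho> :: "('a \<times> 'a) set"
  assumes "semigroup S m"
    and "E_solid S m"
    and "locally_inverse S m"
    and "inverse_congruence S m \<rho>"
    and "\<forall>e\<in>idempotents S m. completely_simple (\<rho> `` {e}) m"
  shows "\<exists>(K :: 'a list set set) (mK :: 'a list set \<Rightarrow> 'a list set \<Rightarrow> 'a list set)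
            (eps :: 'a set \<Rightarrow> 'a list set \<Rightarrow> 'a list set) (\<psi> :: 'a \<Rightarrow> 'a list set \<times> 'a set).
           completely_simple K mK \<and>
           left_action (S // \<rho>) (quot_mult \<rho> m) K mK eps \<and>
           \<psi> ` S \<subseteq> lsd_carrier K (S // \<rho>) (quot_mult \<rho> m) eps \<and>
           inj_on \<psi> S \<and>
           (\<forall>x\<in>S. \<forall>y\<in>S. \<psi> (m x y) = lsd_mult mK (S // \<rho>) (quot_mult \<rho> m) eps (\<psi> x) (\<psi> y)) \<and>
           (\<forall>x\<in>S. \<forall>y\<in>S. snd (\<psi> x) = snd (\<psi> y) \<longleftrightarrow> (x, y) \<in> \<rho>)"
proof -
  interpret completely_simple_extension "S // \<rho>" "quot_mult \<rho> m" S m "\<lambda>x. \<rho> `` {x}"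
    using assms(3-5) by (rule completely_simple_extension_quotient)
  obtain K :: "'a list set set" and mK eps \<psi> where "completely_simple K mK"
    and emb: "lsd_embedding S m (\<lambda>x. \<rho> `` {x}) (S // \<rho>) (quot_mult \<rho> m) K mK eps \<psi>"
    by (rule lsd_embedding_list_set)
  moreover have "snd (\<psi> x) = snd (\<psi> y) \<longleftrightarrow> (x, y) \<in> \<rho>" if "x \<in> S" "y \<in> S" for x y
  proof -
    have "equiv S \<rho>"
      using assms(4) by (simp add: inverse_congruence_def congruence_def)
    then show ?thesis
      using emb that by (simp add: lsd_embedding_def eq_equiv_class_iff)
  qed
  ultimately show ?thesis
    using emb unfolding lsd_embedding_def
    by (intro exI[of _ K] exI[of _ mK] exI[of _ eps] exI[of _ \<psi>]) simp
qed

end
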